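(* $2$-FWL has stronger link discriminating power than $2$-WL. That is: (i) for all finite undirected node-labeled graphs $G=(V,E,l)$, $G'=(V',E',l')$ and all target links $e\in V\times V$, $e'\in V'\times V'$, if $2$-WL distinguishes $(e,G)$ and $(e',G')$, then $2$-FWL distinguishes $(e,G)$ and $(e',G')$; and (ii) there exist graphs $G_1,G_1'$ and target links $e_1,e_1'$ in them such that $2$-FWL distinguishes $(e_1,G_1)$ and $(e_1',G_1')$ but $2$-WL does not.
   Context: Graphs. A labeled graph is $G=(V,E,l)$ with finite node set $V=[n]=\{1,\dots,n\}$, edge set $E\subseteq V\times V$ (undirected, i.e. $E$ is symmetric), and $l:V\to\Sigma$ a node labeling in a label set $\Sigma$. A link is an ordered pair $e=(p,q)\in V\times V$. Multisets are written $\{\!\!\{\cdot\}\!\!\}$. Standing assumption. The target links being compared have unknown edge status: their edge-existence indicator is set to $0$, i.e. target links $e$ in $G$ and $e'$ in $G'$ satisfy $e\notin E$, $e'\notin E'$ (the target link is not part of the observed graph). Both tests assign colors to all pairs in $V\times V$, with initial color $c^{(0)}(p,q)=\big(l(p),l(q),\mathbf 1[(p,q)\in E]\big)$. For $t\ge1$ the updates are as follows, where $f$ and $f_F$ are fixed injective functions (the same for all graphs). $2$-WL: $$c^{(t)}(p,q)=f\Big(c^{(t-1)}(p,q),\ \{\!\!\{c^{(t-1)}(u,q): u\in V\}\!\!\},\ \{\!\!\{c^{(t-1)}(p,v): v\in V\}\!\!\}\Big).$$ $2$-FWL (Folklore $2$-WL): $$c^{(t)}(p,q)=f_F\Big(c^{(t-1)}(p,q),\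 \{\!\!\{\big(c^{(t-1)}(u,q),c^{(t-1)}(p,u)\big): u\in V\}\!\!\}\Big).$$ Each test distinguishes $(e,G)$ and $(e',G')$ unless its own colors satisfy $c^{(t)}(e)=c^{(t)}(e')$ for all $t\ge0$. *)

theory Defs
  imports Main "HOL-Library.Multiset"
begin

text \<open>Only the labels of the nodes \<open>1, \<dots>, num_nodes G\<close> matter; \<open>label G\<close> is total on
  \<^typ>\<open>nat\<close>, but its other values are never used. Self-loops are not excluded.\<close>

record 's lgraph =
  num_nodes :: nat
  edges :: "(nat \<times> nat) set"
  label :: "nat \<Rightarrow> 's"

definition nodes :: "'s lgraph \<Rightarrow> nat set" where
  "nodes G = {1..num_nodes G}"

definition labeled_graph :: "'s lgraph \<Rightarrow> bool" where
  "labeled_graph G \<longleftrightarrow> edges G \<subseteq> nodes G \<times> nodes G \<and> sym (edges G)"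

text \<open>A target link is an ordered pair of nodes, possibly with equal components, that is
  not part of the observed graph.\<close>

definition target_link :: "'s lgraph \<Rightarrow> nat \<times> nat \<Rightarrow> bool" where
  "target_link G e \<longleftrightarrow> e \<in> nodes G \<times> nodes G \<and> e \<notin> edges G"

text \<open>The colors form a set that contains all initial colors (label, label, edge indicator),
  embedded by \<^const>\<open>Inl\<close>. The second summand is an arbitrary supply of further colors.
  The update functions take values in the whole sum, so they may also reuse initial colors.\<close>

type_synonym ('s, 'c) color = "('s \<times> 's \<times> bool) + 'c"

definition initial_color :: "'s lgraph \<Rightarrow> nat \<times> nat \<Rightarrow> ('s, 'c) color" where
  "initial_color G = (\<lambda>(p, q). Inl (label G p, label G q, (p, q) \<in> edges G))"

type_synonym ('s, 'c) wl_update =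
  "('s, 'c) color \<times> ('s, 'c) color multiset \<times> ('s, 'c) color multiset \<Rightarrow> ('s, 'c) color"

type_synonym ('s, 'c) fwl_update =
  "('s, 'c) color \<times> (('s, 'c) color \<times> ('s, 'c) color) multiset \<Rightarrow> ('s, 'c) color"

primrec wl2 :: "('s, 'c) wl_update \<Rightarrow> 's lgraph \<Rightarrow> nat \<Rightarrow> nat \<times> nat \<Rightarrow> ('s, 'c) color" where
  "wl2 f G 0 = initial_color G"
| "wl2 f G (Suc t) = (\<lambda>(p, q).
     f (wl2 f G t (p, q),
        {# wl2 f G t (u, q). u \<in># mset_set (nodes G) #},
        {# wl2 f G t (p, v). v \<in># mset_set (nodes G) #}))"

primrec fwl2 :: "('s, 'c) fwl_update \<Rightarrow> 's lgraph \<Rightarrow> nat \<Rightarrow> nat \<times> nat \<Rightarrow> ('s, 'c) color" where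
  "fwl2 f G 0 = initial_color G"
| "fwl2 f G (Suc t) = (\<lambda>(p, q).
     f (fwl2 f G t (p, q),
        {# (fwl2 f G t (u, q), fwl2 f G t (p, u)). u \<in># mset_set (nodes G) #}))"

definition wl2_distinguishes ::
  "('s, 'c) wl_update \<Rightarrow> (nat \<times> nat) \<times> 's lgraph \<Rightarrow> (nat \<times> nat) \<times> 's lgraph \<Rightarrow> bool" where
  "wl2_distinguishes f = (\<lambda>(e, G) (e', G'). \<not> (\<forall>t. wl2 f G t e = wl2 f G' t e'))"

definition fwl2_distinguishes ::
  "('s, 'c) fwl_update \<Rightarrow> (nat \<times> nat) \<times> 's lgraph \<Rightarrow> (nat \<times> nat) \<times> 's lgraph \<Rightarrow> bool" where
  "fwl2_distinguishes f = (\<lambda>(e, G) (e', G'). \<not> (\<forall>t. fwl2 f G t e = fwl2 f G' t e'))"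

end

theory Submission
  imports Defs
begin

text \<open>The folklore multiset of pairs projects onto the two multisets of \<open>2\<close>-WL, so folklore
  colors refine \<open>2\<close>-WL colors in every round. For strictness, on a regular graph with constant
  labels \<open>2\<close>-WL never sees more of a link than whether it is an edge, whereas one folklore
  round detects whether its end points have a common neighbor; the two kinds of non-edges at
  distances 2 and 3 in a hexagon are thus told apart by \<open>2\<close>-FWL only.\<close>

text \<open>Equality of the two images matches the elements of \<open>M\<close> with those of
  \<open>M'\<close> so that matched elements agree under \<open>a\<close> and \<open>a'\<close>; by
  \<open>factor\<close> they then agree under \<open>b\<close> and \<open>b'\<close>. The induction
  removes one matched pair at a time.\<close>

lemma image_mset_eq_if_factor:
  assumes eq: "image_mset a M = image_mset a' M'"
    and factor: "\<And>x y. x \<in># M \<Longrightarrow> y \<in># M' \<Longrightarrow> a x = a' y \<Longrightarrow> b x = b' y"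
  shows "image_mset b M = image_mset b' M'"
  using assms
proof (induction M arbitrary: M')
  case empty
  then show ?case by simp
next
  case (add x M)
  from add.prems(1) have "a x \<in># image_mset a' M'"
    by (metis image_mset_add_mset union_single_eq_member)
  then obtain y where y: "y \<in># M'" "a x = a' y" by auto
  then obtain N where M': "M' = add_mset y N" by (meson mset_add)
  have "image_mset b M = image_mset b' N"
    using add.prems y by (intro add.IH) (auto simp: M')
  then show ?case using add.prems(2)[of x y] y M' by simp
qed

text \<open>Injectivity of \<open>f\<^sub>F\<close> lets a folklore round be undone, exposing the
  previous color and the multiset of pairs. The links stay arbitrary in the induction because a
  round looks at all links that share an end point with the given one.\<close>

lemma fwl2_refines_wl2:
  assumes "inj f\<^sub>F" and "fwl2 f\<^sub>F G t e = fwl2 f\<^sub>F G' t e'"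
  shows "wl2 f G t e = wl2 f G' t e'"
  using assms(2)
proof (induction t arbitrary: e e')
  case 0
  then show ?case by (simp add: initial_color_def split: prod.splits)
next
  case (Suc t)
  obtain p q p' q' where e: "e = (p, q)" "e' = (p', q')" by (meson surj_pair)
  let ?F = "\<lambda>p q u. (fwl2 f\<^sub>F G t (u, q), fwl2 f\<^sub>F G t (p, u))"
  let ?F' = "\<lambda>p q u. (fwl2 f\<^sub>F G' t (u, q), fwl2 f\<^sub>F G' t (p, u))"
  have color: "fwl2 f\<^sub>F G t (p, q) = fwl2 f\<^sub>F G' t (p', q')"
    and pairs: "image_mset (?F p q) (mset_set (nodes G)) = image_mset (?F' p' q') (mset_set (nodes G'))"
    using injD[OF assms(1)] Suc.prems by (auto simp: e)
  \<comment> \<open>The first components of the pairs determine the colors in the column of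
    \<open>q\<close>, the second components those in the row of \<open>p\<close>.\<close>
  have "{# wl2 f G t (u, q). u \<in># mset_set (nodes G) #} = {# wl2 f G' t (u, q'). u \<in># mset_set (nodes G') #}"
    "{# wl2 f G t (p, u). u \<in># mset_set (nodes G) #} = {# wl2 f G' t (p', u). u \<in># mset_set (nodes G') #}"
    by (rule image_mset_eq_if_factor[OF pairs], simp add: Suc.IH)+
  then show ?case using Suc.IH[OF color] by (simp add: e)
qed

text \<open>A multiset of truth values is fixed by its size, here \<open>card A\<close>, and its
  number of \<open>True\<close> entries.\<close>

lemma image_mset_pred_eq:
  assumes "finite A" and "card {x \<in> A. P x} = card {x \<in> A. Q x}"
  shows "image_mset P (mset_set A) = image_mset Q (mset_set A)"
proof -
  have split: "image_mset R (mset_set A) =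
      replicate_mset (card {x \<in> A. R x}) True + replicate_mset (card A - card {x \<in> A. R x}) False"
    for R
  proof (rule multiset_eqI)
    fix b
    have "count (image_mset R (mset_set A)) b = card {x \<in> A. R x = b}"
      using assms(1) by (simp add: count_image_mset vimage_def Int_def conj_commute)
    moreover have "card {x \<in> A. \<not> R x} = card A - card {x \<in> A. R x}"
      using card_Diff_subset[of "{x \<in> A. R x}" A] assms(1)
      by (simp add: set_diff_eq cong: conj_cong)
    ultimately show "count (image_mset R (mset_set A)) b = count (replicate_mset (card {x \<in> A. R x}) True +
        replicate_mset (card A - card {x \<in> A. R x}) False) b"
      by (cases b) simp_all
  qed
  show ?thesis unfolding split assms(2) ..
qed

text \<open>By induction, the color of a link depends only on its edge indicator: every row has
  exactly \<open>d\<close> edges among its links, so all rows carry the same multiset of colors, and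
  by symmetry so do all columns.\<close>

lemma wl2_regular:
  assumes G: "labeled_graph G"
    and label: "\<And>v. v \<in> nodes G \<Longrightarrow> label G v = a"
    and degree: "\<And>v. v \<in> nodes G \<Longrightarrow> card {u \<in> nodes G. (v, u) \<in> edges G} = d"
    and "p \<in> nodes G" "q \<in> nodes G" "p' \<in> nodes G" "q' \<in> nodes G"
    and "(p, q) \<in> edges G \<longleftrightarrow> (p', q') \<in> edges G"
  shows "wl2 f G t (p, q) = wl2 f G t (p', q')"
  using assms(4-)
proof (induction t arbitrary: p q p' q')
  case 0
  then show ?case by (simp add: initial_color_def label)
next
  case (Suc t)
  have fin: "finite (nodes G)" by (simp add: nodes_def)
  have sym: "(u, v) \<in> edges G \<longleftrightarrow> (v, u) \<in> edges G" for u v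
    using G by (auto simp: labeled_graph_def dest: symD)
  have nbrs: "{# (v, u) \<in> edges G. u \<in># mset_set (nodes G) #} = {# (w, u) \<in> edges G. u \<in># mset_set (nodes G) #}"
    if "v \<in> nodes G" "w \<in> nodes G" for v w
    by (rule image_mset_pred_eq) (simp_all add: fin degree that)
  \<comment> \<open>The degree counts pairs \<open>(q, u)\<close>, whereas the column consists of
    the links \<open>(u, q)\<close>; symmetry of the edges bridges the two.\<close>
  have "wl2 f G t (u, q) = wl2 f G t (u', q')"
    if "u \<in># mset_set (nodes G)" "u' \<in># mset_set (nodes G)"
      "((q, u) \<in> edges G) = ((q', u') \<in> edges G)" for u u'
    using that Suc.prems fin sym[of u q] sym[of u' q'] by (intro Suc.IH) simp_all
  then have "{# wl2 f G t (u, q). u \<in># mset_set (nodes G) #} = {# wl2 f G t (u, q'). u \<in># mset_set (nodes G) #}"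
    by (rule image_mset_eq_if_factor[OF nbrs[OF \<open>q \<in> nodes G\<close> \<open>q' \<in> nodes G\<close>]])
  moreover have "wl2 f G t (p, v) = wl2 f G t (p', v')"
    if "v \<in># mset_set (nodes G)" "v' \<in># mset_set (nodes G)"
      "((p, v) \<in> edges G) = ((p', v') \<in> edges G)" for v v'
    using that Suc.prems fin by (intro Suc.IH) simp_all
  then have "{# wl2 f G t (p, v). v \<in># mset_set (nodes G) #} = {# wl2 f G t (p', v). v \<in># mset_set (nodes G) #}"
    by (rule image_mset_eq_if_factor[OF nbrs[OF \<open>p \<in> nodes G\<close> \<open>p' \<in> nodes G\<close>]])
  ultimately show ?case using Suc.IH[OF Suc.prems] by simp
qed

text \<open>The label type is arbitrary, so \<open>undefined\<close> serves as the one label known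
  to exist. The directed cycle \<open>C\<close> is made symmetric by adding its converse.\<close>

definition hexagon :: "'s lgraph" where
  "hexagon = \<lparr>num_nodes = 6,
     edges = (let C = {(1, 2), (2, 3), (3, 4), (4, 5), (5, 6), (6, 1)} in C \<union> C\<inverse>),
     label = (\<lambda>_. undefined)\<rparr>"

lemma nodes_hexagon: "nodes hexagon = {1, 2, 3, 4, 5, 6}"
  by (auto simp: nodes_def hexagon_def)

lemma label_hexagon: "label hexagon v = undefined"
  by (simp add: hexagon_def)

lemma labeled_graph_hexagon: "labeled_graph (hexagon :: 's lgraph)"
  unfolding labeled_graph_def
proof
  show "edges (hexagon :: 's lgraph) \<subseteq> nodes (hexagon :: 's lgraph) \<times> nodes (hexagon :: 's lgraph)"
    by (auto simp: hexagon_def nodes_def)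
  show "sym (edges (hexagon :: 's lgraph))"
    unfolding hexagon_def Let_def lgraph.simps by (rule sym_Un_converse)
qed

lemma degree_hexagon:
  assumes "v \<in> nodes hexagon"
  shows "card {u \<in> nodes hexagon. (v, u) \<in> edges hexagon} = 2"
proof -
  \<comment> \<open>Predecessor and successor on the cycle, wrapping around at 1 and 6.\<close>
  have nbrs: "{u \<in> nodes hexagon. (v, u) \<in> edges hexagon} =
      {if v = 1 then 6 else v - 1, if v = 6 then 1 else v + 1}"
    using assms unfolding nodes_hexagon
    by (elim insertE emptyE; hypsubst) (simp_all add: hexagon_def set_eq_iff, presburger+)
  show ?thesis unfolding nbrs using assms unfolding nodes_hexagon by auto
qed

lemma wl2_hexagon: "wl2 f hexagon t (1, 3) = wl2 f hexagon t (1, 4)"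
  by (rule wl2_regular[OF labeled_graph_hexagon label_hexagon degree_hexagon])
    (simp_all add: nodes_hexagon, simp add: hexagon_def)

text \<open>Node 2 is a common neighbor of 1 and 3, while 1 and 4 are opposite and have
  none.\<close>

lemma fwl2_hexagon:
  fixes f :: "('s, 'd) fwl_update"
  assumes "inj f"
  shows "fwl2 f hexagon 1 (1, 3) \<noteq> fwl2 f hexagon 1 (1, 4)"
proof
  let ?c = "initial_color hexagon :: nat \<times> nat \<Rightarrow> ('s, 'd) color"
  let ?M = "\<lambda>q. {# (?c (u, q), ?c (1, u)). u \<in># mset_set (nodes (hexagon :: 's lgraph)) #}"
  \<comment> \<open>All edges start with this color, so \<open>(?edge, ?edge)\<close> occurs in
    \<open>?M q\<close> exactly when 1 and \<open>q\<close> have a common neighbor.\<close>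
  let ?edge = "Inl (undefined, undefined, True) :: ('s, 'd) color"
  assume "fwl2 f hexagon 1 (1, 3) = fwl2 f hexagon 1 (1, 4)"
  then have "f (?c (1, 3), ?M 3) = f (?c (1, 4), ?M 4)" by (simp only: One_nat_def fwl2.simps prod.case)
  then have "?M 3 = ?M 4" by (auto dest: injD[OF assms])
  then have "(?edge, ?edge) \<in># ?M 3 \<longleftrightarrow> (?edge, ?edge) \<in># ?M 4" by (rule arg_cong)
  moreover have "(?edge, ?edge) \<in># ?M q \<longleftrightarrow>
      (\<exists>u \<in> nodes (hexagon :: 's lgraph). (u, q) \<in> edges (hexagon :: 's lgraph) \<and> (1, u) \<in> edges (hexagon :: 's lgraph))" for q
    by (auto simp: initial_color_def label_hexagon nodes_def)
  ultimately show False unfolding nodes_hexagon by (simp add: hexagon_def)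
qed

theorem theorem4p2:
  fixes f :: "('s, 'c) wl_update" and f\<^sub>F :: "('s, 'd) fwl_update"
  assumes "inj f" and "inj f\<^sub>F"
  shows "(\<forall>(G :: 's lgraph) (G' :: 's lgraph) e e'.
            labeled_graph G \<and> labeled_graph G' \<and> target_link G e \<and> target_link G' e' \<and>
            wl2_distinguishes f (e, G) (e', G') \<longrightarrow> fwl2_distinguishes f\<^sub>F (e, G) (e', G')) \<and>
         (\<exists>(G\<^sub>1 :: 's lgraph) (G\<^sub>1' :: 's lgraph) e\<^sub>1 e\<^sub>1'.
            labeled_graph G\<^sub>1 \<and> labeled_graph G\<^sub>1' \<and> target_link G\<^sub>1 e\<^sub>1 \<and> target_link G\<^sub>1' e\<^sub>1' \<and>
            fwl2_distinguishes f\<^sub>F (e\<^sub>1, G\<^sub>1) (e\<^sub>1', G\<^sub>1') \<and>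
            \<not> wl2_distinguishes f (e\<^sub>1, G\<^sub>1) (e\<^sub>1', G\<^sub>1'))"
proof (intro conjI allI impI)
  fix G G' :: "'s lgraph" and e e'
  assume "labeled_graph G \<and> labeled_graph G' \<and> target_link G e \<and> target_link G' e' \<and>
    wl2_distinguishes f (e, G) (e', G')"
  then show "fwl2_distinguishes f\<^sub>F (e, G) (e', G')"
    using fwl2_refines_wl2[OF assms(2)]
    unfolding wl2_distinguishes_def fwl2_distinguishes_def by fastforce
next
  \<comment> \<open>Both witnesses live in the same graph: the hexagon is used for
    \<open>G\<^sub>1\<close> and for \<open>G\<^sub>1'\<close>.\<close>
  have "target_link hexagon (1, 3)" "target_link hexagon (1, 4)"
    unfolding target_link_def nodes_hexagon by (simp_all add: hexagon_def)
  moreover have "fwl2_distinguishes f\<^sub>F ((1, 3), hexagon) ((1, 4), hexagon)"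
    using fwl2_hexagon[OF assms(2)] unfolding fwl2_distinguishes_def by blast
  moreover have "\<not> wl2_distinguishes f ((1, 3), hexagon) ((1, 4), hexagon)"
    using wl2_hexagon[of f] by (simp add: wl2_distinguishes_def)
  ultimately show "\<exists>(G\<^sub>1 :: 's lgraph) (G\<^sub>1' :: 's lgraph) e\<^sub>1 e\<^sub>1'.
            labeled_graph G\<^sub>1 \<and> labeled_graph G\<^sub>1' \<and> target_link G\<^sub>1 e\<^sub>1 \<and> target_link G\<^sub>1' e\<^sub>1' \<and>
            fwl2_distinguishes f\<^sub>F (e\<^sub>1, G\<^sub>1) (e\<^sub>1', G\<^sub>1') \<and>
            \<not> wl2_distinguishes f (e\<^sub>1, G\<^sub>1) (e\<^sub>1', G\<^sub>1')"
    using labeled_graph_hexagon by blast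
qed

end
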